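(* The path $P_n$ admits $q$-Laplacian perfect vertex state transfer between its end vertices if and only if $n=2,3$. For $n=2$, perfect state transfer occurs for any $q$ at time $\frac{\pi}{2q}$. For $n=3$, perfect state transfer occurs precisely when $q=\sqrt{\frac{8l^2}{k^2-l^2}}$, where $k$ and $l$ are integers satisfying $k>l$ and $k\not\equiv l\pmod 2$, and the state transfer time is $\frac{\pi(k^2-l^2)}{4l}$.
   Context: $P_n$ is the (unweighted, no potential) path on $n$ vertices labeled $1,\dots,n$, with $j,k$ adjacent whenever $|j-k|=1$; its end vertices are $1$ and $n$. Let $A$ be its adjacency matrix and $\Delta$ its diagonal degree matrix. For a non-zero real parameter $q$, the $q$-Laplacian matrix of $P_n$ is $\mathscr{L}=(1-q^2)I+q^2\Delta-qA$. $q$-Laplacian perfect vertex state transfer (PST) between vertices $u$ and $v$ at time $\tau\in\mathbb{R}^+$ means that $\exp(i\tau\mathscr{L})\mathbf{e}_u=\gamma\mathbf{e}_v$ for some $\gamma\in\mathbb{C}$, where $\mathbf{e}_u$ is the characteristic vector of $u$.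
   Formalization: Since q may be negative and times must be positive, q is replaced by |q| in the time π/(2q) and in the condition q = √(8l²/(k²−l²)); as written the claim fails, e.g., for n=3, q=−√(8/3). Only pairs k, l giving a positive time count as transfer times. *)

theory Defs
  imports Complex_Main "Jordan_Normal_Form.Matrix"
begin

text \<open>Matrix exponential, as the entrywise limit of the power series. The series always
  converges, see \<open>mat_exp_summable\<close> below.\<close>

definition mat_exp :: "complex mat \<Rightarrow> complex mat" where
  "mat_exp M = mat (dim_row M) (dim_row M)
     (\<lambda>(i, j). \<Sum>k. (M ^\<^sub>m k) $$ (i, j) / fact k)"

lemma mat_pow_entry_bound:
  fixes M :: "complex mat"
  assumes M: "M \<in> carrier_mat n n"
    and C: "\<And>i j. i < n \<Longrightarrow> j < n \<Longrightarrow> norm (M $$ (i, j)) \<le> C"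
    and C0: "0 \<le> C" and ij: "i < n" "j < n"
  shows "norm ((M ^\<^sub>m k) $$ (i, j)) \<le> (real n * C) ^ k"
  using ij
proof (induction k arbitrary: i j)
  case 0
  then show ?case using M by auto
next
  case (Suc k)
  have Mk: "M ^\<^sub>m k \<in> carrier_mat n n" using M by simp
  have "(M ^\<^sub>m Suc k) $$ (i, j) = (\<Sum>l<n. (M ^\<^sub>m k) $$ (i, l) * M $$ (l, j))"
    using M Mk Suc.prems by (simp add: scalar_prod_def atLeast0LessThan)
  also have "norm \<dots> \<le> (\<Sum>l<n. (real n * C) ^ k * C)"
    using Suc C C0 by (intro sum_norm_le) (simp add: norm_mult mult_mono)
  also have "\<dots> = (real n * C) ^ Suc k" by simp
  finally show ?case .
qed

lemma mat_exp_summable: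
  fixes M :: "complex mat"
  assumes M: "M \<in> carrier_mat n n" and ij: "i < n" "j < n"
  shows "summable (\<lambda>k. (M ^\<^sub>m k) $$ (i, j) / fact k)"
proof -
  define C where "C = (\<Sum>p\<in>{..<n} \<times> {..<n}. norm (M $$ p))"
  have C: "norm (M $$ (i, j)) \<le> C" if "i < n" "j < n" for i j
    unfolding C_def using that by (intro member_le_sum) auto
  have C0: "0 \<le> C" unfolding C_def by (intro sum_nonneg) simp
  have "summable (\<lambda>k. inverse (fact k) * (real n * C) ^ k)"
    by (rule summable_exp)
  moreover have "norm ((M ^\<^sub>m k) $$ (i, j) / fact k) \<le> inverse (fact k) * (real n * C) ^ k" for k
    using mult_left_mono[OF mat_pow_entry_bound[OF M C C0 ij, of k], of "inverse (fact k)"]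
    by (simp only: divide_inverse norm_mult norm_inverse norm_fact mult.commute
        inverse_nonnegative_iff_nonnegative fact_ge_zero simp_thms)
  ultimately show ?thesis
    by (rule summable_comparison_test'[where N = 0])
qed

text \<open>The vertices of the path are \<open>1, \<dots>, n\<close>, whereas matrix and vector indices start at \<open>0\<close>;
  vertex \<open>j\<close> corresponds to index \<open>j - 1\<close>.\<close>

definition path_adj :: "nat \<Rightarrow> nat \<Rightarrow> nat \<Rightarrow> bool" where
  "path_adj n j k \<longleftrightarrow> j \<in> {1..n} \<and> k \<in> {1..n} \<and> \<bar>int j - int k\<bar> = 1"

definition path_adjacency_mat :: "nat \<Rightarrow> real mat" where
  "path_adjacency_mat n = mat n n (\<lambda>(i, j). if path_adj n (i + 1) (j + 1) then 1 else 0)"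

definition path_degree_mat :: "nat \<Rightarrow> real mat" where
  "path_degree_mat n = mat n n
     (\<lambda>(i, j). if i = j then real (card {k. path_adj n (i + 1) k}) else 0)"

definition path_q_laplacian :: "nat \<Rightarrow> real \<Rightarrow> real mat" where
  "path_q_laplacian n q =
     (1 - q\<^sup>2) \<cdot>\<^sub>m 1\<^sub>m n + q\<^sup>2 \<cdot>\<^sub>m path_degree_mat n - q \<cdot>\<^sub>m path_adjacency_mat n"

definition char_vec :: "nat \<Rightarrow> nat \<Rightarrow> complex vec" where
  "char_vec n u = unit_vec n (u - 1)"

definition path_q_pst :: "nat \<Rightarrow> real \<Rightarrow> nat \<Rightarrow> nat \<Rightarrow> real \<Rightarrow> bool" where
  "path_q_pst n q u v \<tau> \<longleftrightarrow> u \<in> {1..n} \<and> v \<in> {1..n} \<and> \<tau> > 0 \<and>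
     (\<exists>\<gamma>. mat_exp ((\<i> * complex_of_real \<tau>) \<cdot>\<^sub>m map_mat complex_of_real (path_q_laplacian n q))
            *\<^sub>v char_vec n u = \<gamma> \<cdot>\<^sub>v char_vec n v)"

text \<open>The \<open>q\<close>-Laplacians for \<open>q\<close> and \<open>- q\<close> are conjugate by a diagonal
  matrix of signs, so transfer times depend only on \<open>\<bar>q\<bar>\<close>. Hence, for \<open>q\<close> ranging over all non-zero
  reals and times being positive, the time for two vertices is \<open>pi / (2 * \<bar>q\<bar>)\<close>, and the equation
  characterising \<open>q\<close> for three vertices is one for \<open>\<bar>q\<bar>\<close>; for \<open>q > 0\<close> the bars can be dropped.

  In the equation \<open>\<bar>q\<bar> = sqrt (8 * l\<^sup>2 / (k\<^sup>2 - l\<^sup>2))\<close> with \<open>q \<noteq> 0\<close>, the conventions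
  \<open>x / 0 = 0\<close> and \<open>sqrt (- x) = - sqrt x\<close> are harmless: a positive value of \<open>sqrt\<close> forces
  \<open>l \<noteq> 0\<close> and \<open>k\<^sup>2 > l\<^sup>2\<close>. If also \<open>pi * (k\<^sup>2 - l\<^sup>2) / (4 * l)\<close> is a positive time, then \<open>l > 0\<close>.\<close>

end

theory Submission
  imports Defs "HOL-Computational_Algebra.Fundamental_Theorem_Algebra"
begin

text \<open>
  The reflection of the path commutes with its \<open>q\<close>-Laplacian, so eigenvectors can be taken symmetric or
  skew-symmetric. Testing the transfer equation against an eigenvector \<open>v\<close> with eigenvalue \<open>\<lambda>\<close> turns it
  into \<open>exp (\<i> * \<tau> * \<lambda>) * v 0 = \<gamma> * v (n - 1)\<close>. Perfect transfer between the ends therefore means that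
  all symmetric eigenvalues have phase \<open>\<gamma>\<close> and all skew-symmetric ones have phase \<open>- \<gamma>\<close>; in particular
  each symmetric eigenvalue differs from each skew-symmetric one by an odd multiple of \<open>pi / \<tau>\<close>.

  For two and three vertices there are at most three eigenvalues, all explicit. With three vertices,
  relative to the skew-symmetric eigenvalue \<open>1\<close> the symmetric ones are the numbers \<open>a\<close> and \<open>b\<close> with
  \<open>a + b = q\<^sup>2\<close> and \<open>a * b = - 2 * q\<^sup>2\<close>. Writing \<open>\<tau> * a = (l + k) * pi\<close> and \<open>\<tau> * b = (l - k) * pi\<close> and
  solving for \<open>q\<close> and \<open>\<tau>\<close> gives the stated formulas (\<open>path_3_q_pst_iff\<close>).

  For longer paths an arithmetic obstruction rules transfer out. After an affine change of variable
  the symmetric eigenvalues are the roots of a monic polynomial \<open>f\<close> and the skew-symmetric ones those of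
  a monic \<open>g\<close>. The three-term recurrence behind them shows that the resultant of \<open>f\<close> and \<open>g\<close> is
  \<open>2^m\<close> up to sign, where \<open>m\<close> is half the number of vertices, rounded down: consecutive solutions of
  the recurrence have resultant \<open>1\<close> up to sign (\<open>abs_resultant_path_poly\<close>). The resultant is the product of
  all differences of roots, hence a power of the common step \<open>d\<close> times an odd number. Comparing the
  sums of the roots, or for an odd number of vertices the sums of their squares, gives an integer \<open>N\<close>
  with \<open>\<bar>d * N\<bar> = 2\<close> or \<open>d\<^sup>2 * N = 4\<close>. The exponents of 2 then fail to match when \<open>m \<ge> 2\<close>
  (\<open>no_odd_differences_same_degree\<close> for an even number of vertices,
  \<open>no_odd_differences_consecutive_degrees\<close> for an odd one).
\<close>

section \<open>Matrix exponentials and left eigenvectors\<close>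

lemma pow_mat_left_eigenvector:
  fixes M :: "complex mat"
  assumes M: "M \<in> carrier_mat n n"
    and eig: "\<And>j. j < n \<Longrightarrow> (\<Sum>i<n. v i * M $$ (i, j)) = c * v j"
    and j: "j < n"
  shows "(\<Sum>i<n. v i * (M ^\<^sub>m k) $$ (i, j)) = c ^ k * v j"
  using j
proof (induction k arbitrary: j)
  case 0
  have "(\<Sum>i<n. v i * (M ^\<^sub>m 0) $$ (i, j)) = (\<Sum>i<n. if i = j then v i else 0)"
    using M 0 by (intro sum.cong) auto
  then show ?case using 0 by simp
next
  case (Suc k)
  have Mk: "M ^\<^sub>m k \<in> carrier_mat n n" using M by simp
  have "(\<Sum>i<n. v i * (M ^\<^sub>m Suc k) $$ (i, j))
      = (\<Sum>i<n. \<Sum>l<n. v i * (M ^\<^sub>m k) $$ (i, l) * M $$ (l, j))"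
    using M Mk Suc.prems
    by (intro sum.cong) (simp_all add: scalar_prod_def atLeast0LessThan sum_distrib_left mult_ac)
  also have "\<dots> = (\<Sum>l<n. (\<Sum>i<n. v i * (M ^\<^sub>m k) $$ (i, l)) * M $$ (l, j))"
    by (subst sum.swap) (simp add: sum_distrib_right)
  also have "\<dots> = (\<Sum>l<n. c ^ k * (v l * M $$ (l, j)))"
    using Suc.IH by (intro sum.cong) (simp_all add: mult_ac)
  also have "\<dots> = c ^ k * (c * v j)"
    using eig[OF Suc.prems] by (simp add: sum_distrib_left[symmetric])
  finally show ?case by (simp add: mult_ac)
qed

lemma mat_exp_left_eigenvector:
  fixes M :: "complex mat"
  assumes M: "M \<in> carrier_mat n n"
    and eig: "\<And>j. j < n \<Longrightarrow> (\<Sum>i<n. v i * M $$ (i, j)) = c * v j"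
    and j: "j < n"
  shows "(\<Sum>i<n. v i * mat_exp M $$ (i, j)) = exp c * v j"
proof -
  have "(\<lambda>k. v i * ((M ^\<^sub>m k) $$ (i, j) / fact k)) sums (v i * mat_exp M $$ (i, j))"
    if "i < n" for i
    using summable_sums[OF mat_exp_summable[OF M that j]] that j M
    by (intro sums_mult) (simp add: mat_exp_def)
  then have "(\<lambda>k. \<Sum>i<n. v i * ((M ^\<^sub>m k) $$ (i, j) / fact k))
      sums (\<Sum>i<n. v i * mat_exp M $$ (i, j))"
    by (intro sums_sum) simp
  moreover have "(\<Sum>i<n. v i * ((M ^\<^sub>m k) $$ (i, j) / fact k)) = c ^ k /\<^sub>R fact k * v j" for k
    using pow_mat_left_eigenvector[OF M eig j, of k]
    by (simp add: sum_divide_distrib[symmetric] scaleR_conv_of_real field_simps)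
  ultimately have "(\<lambda>k. c ^ k /\<^sub>R fact k * v j) sums (\<Sum>i<n. v i * mat_exp M $$ (i, j))"
    by simp
  then show ?thesis
    using sums_unique2 sums_mult2[OF exp_converges[of c], of "v j"] by blast
qed

section \<open>State transfer between the ends of a path\<close>

definition path_q_evolution :: "nat \<Rightarrow> real \<Rightarrow> real \<Rightarrow> complex mat" where
  "path_q_evolution n q \<tau> =
     mat_exp ((\<i> * complex_of_real \<tau>) \<cdot>\<^sub>m map_mat complex_of_real (path_q_laplacian n q))"

lemma path_q_laplacian_carrier: "path_q_laplacian n q \<in> carrier_mat n n"
  unfolding path_q_laplacian_def path_degree_mat_def path_adjacency_mat_def
  by (intro minus_carrier_mat add_carrier_mat smult_carrier_mat) simp_all

lemma path_degree:
  assumes "n \<ge> 2" "i < n"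
  shows "card {k. path_adj n (i + 1) k} = (if i = 0 \<or> i = n - 1 then 1 else 2)"
proof -
  consider "i = 0" | "i \<noteq> 0" "i = n - 1" | "i \<noteq> 0" "i \<noteq> n - 1" by blast
  then show ?thesis
  proof cases
    case 1
    then have "{k. path_adj n (i + 1) k} = {2}"
      using assms by (auto simp: path_adj_def)
    then show ?thesis using 1 by simp
  next
    case 2
    then have "{k. path_adj n (i + 1) k} = {i}"
      using assms by (auto simp: path_adj_def)
    then show ?thesis using 2 by simp
  next
    case 3
    then have "{k. path_adj n (i + 1) k} = {i, i + 2}"
      using assms by (auto simp: path_adj_def)
    then show ?thesis using 3 by simp
  qed
qed

lemma path_q_laplacian_entry:
  assumes "n \<ge> 2" "i < n" "j < n"
  shows "path_q_laplacian n q $$ (i, j) =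
    (if i = j then (if j = 0 \<or> j = n - 1 then 1 else 1 + q\<^sup>2)
     else if i = Suc j \<or> Suc i = j then - q else 0)"
proof -
  have "path_q_laplacian n q $$ (i, j) = (1 - q\<^sup>2) * (if i = j then 1 else 0)
      + q\<^sup>2 * (if i = j then real (card {k. path_adj n (i + 1) k}) else 0)
      - q * (if path_adj n (i + 1) (j + 1) then 1 else 0)"
    using assms by (simp add: path_q_laplacian_def path_degree_mat_def path_adjacency_mat_def)
  moreover have "path_adj n (i + 1) (j + 1) \<longleftrightarrow> i = Suc j \<or> Suc i = j"
    using assms by (auto simp: path_adj_def)
  ultimately show ?thesis
    unfolding path_degree[OF assms(1,2)] by simp
qed

text \<open>The eigenvector equation of the \<open>q\<close>-Laplacian, divided by \<open>q\<close> and written in the variable \<open>x\<close>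
  for which the interior rows become the recurrence of the adjacency matrix, free of \<open>q\<close>; the two end
  rows keep the term \<open>- q\<close>. See \<open>path_q_eigenvalue\<close> for the eigenvalue in terms of \<open>x\<close>.\<close>

definition path_eigenvector :: "nat \<Rightarrow> real \<Rightarrow> complex \<Rightarrow> (nat \<Rightarrow> complex) \<Rightarrow> bool" where
  "path_eigenvector n q x v \<longleftrightarrow> v 1 = (x - q) * v 0 \<and> v (n - 2) = (x - q) * v (n - 1) \<and>
     (\<forall>j. j + 2 < n \<longrightarrow> v (j + 2) = x * v (j + 1) - v j)"

definition path_q_eigenvalue :: "real \<Rightarrow> complex \<Rightarrow> complex" where
  "path_q_eigenvalue q x = 1 + (of_real q)\<^sup>2 - of_real q * x"

lemma path_q_laplacian_left_eigenvector:
  assumes n: "n \<ge> 2" and v: "path_eigenvector n q x v" and j: "j < n"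
  shows "(\<Sum>i<n. v i * complex_of_real (path_q_laplacian n q $$ (i, j))) = path_q_eigenvalue q x * v j"
proof -
  have left: "v 1 = (x - q) * v 0" and right: "v (n - 2) = (x - q) * v (n - 1)"
    and interior: "\<And>j. j + 2 < n \<Longrightarrow> v (j + 2) = x * v (j + 1) - v j"
    using v by (simp_all add: path_eigenvector_def)
  let ?d = "if j = 0 \<or> j = n - 1 then 1 else 1 + (complex_of_real q)\<^sup>2"
  have "(\<Sum>i<n. v i * complex_of_real (path_q_laplacian n q $$ (i, j)))
     = (\<Sum>i<n. (if i = j then ?d * v j else 0) + (if i = Suc j then - q * v (Suc j) else 0)
          + (if i = j - 1 then (if j = 0 then 0 else - q * v (j - 1)) else 0))"
    using j n by (intro sum.cong) (auto simp: path_q_laplacian_entry)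
  also have "\<dots> = ?d * v j + (if Suc j < n then - q * v (Suc j) else 0)
      + (if j = 0 then 0 else - q * v (j - 1))"
    using j by (simp add: sum.distrib)
  also have "\<dots> = path_q_eigenvalue q x * v j"
  proof -
    consider "j = 0" | "j \<noteq> 0" "j = n - 1" | "j \<noteq> 0" "j \<noteq> n - 1" by blast
    then show ?thesis
    proof cases
      case 1
      have step: "v (Suc 0) = (x - q) * v 0" using left by simp
      show ?thesis using 1 n by (simp add: path_q_eigenvalue_def step algebra_simps power2_eq_square)
    next
      case 2
      obtain i where i: "n = Suc (Suc i)" using le_Suc_ex[OF n] by auto
      have step: "v i = (x - q) * v (Suc i)" using right by (simp add: i)
      show ?thesis using 2 by (simp add: path_q_eigenvalue_def i step algebra_simps power2_eq_square)
    next
      case 3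
      then obtain i where i: "j = i + 1" by (cases j) auto
      have lt: "i + 2 < n" using 3 j i by simp
      then have step: "v (Suc (Suc i)) = x * v (Suc i) - v i" using interior[of i] by simp
      show ?thesis using 3 lt by (simp add: path_q_eigenvalue_def i step algebra_simps power2_eq_square)
    qed
  qed
  finally show ?thesis .
qed

lemma path_q_evolution_left_eigenvector:
  assumes "n \<ge> 2" "path_eigenvector n q x v"
  shows "(\<Sum>i<n. v i * path_q_evolution n q \<tau> $$ (i, 0)) = exp (\<i> * of_real \<tau> * path_q_eigenvalue q x) * v 0"
  unfolding path_q_evolution_def
proof (rule mat_exp_left_eigenvector)
  fix j assume j: "j < n"
  have "(\<Sum>i<n. v i * ((\<i> * complex_of_real \<tau>) \<cdot>\<^sub>m
            map_mat complex_of_real (path_q_laplacian n q)) $$ (i, j))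
      = (\<Sum>i<n. \<i> * of_real \<tau> * (v i * complex_of_real (path_q_laplacian n q $$ (i, j))))"
    using j path_q_laplacian_carrier[of n q] by (intro sum.cong) auto
  also have "\<dots> = \<i> * of_real \<tau> * path_q_eigenvalue q x * v j"
    using path_q_laplacian_left_eigenvector[OF assms j]
    by (simp add: sum_distrib_left[symmetric] mult_ac)
  finally show "(\<Sum>i<n. v i * ((\<i> * complex_of_real \<tau>) \<cdot>\<^sub>m
            map_mat complex_of_real (path_q_laplacian n q)) $$ (i, j))
      = \<i> * of_real \<tau> * path_q_eigenvalue q x * v j" .
qed (use assms(1) path_q_laplacian_carrier[of n q] in auto)

lemma path_q_pst_ends_iff:
  assumes n: "n \<ge> 2"
  shows "path_q_pst n q 1 n \<tau> \<longleftrightarrow> \<tau> > 0 \<and> (\<forall>i<n - 1. path_q_evolution n q \<tau> $$ (i, 0) = 0)"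
proof -
  define U where "U = path_q_evolution n q \<tau>"
  have U: "U \<in> carrier_mat n n"
    using path_q_laplacian_carrier[of n q] by (simp add: U_def path_q_evolution_def mat_exp_def)
  have column: "U *\<^sub>v char_vec n 1 = col U 0"
    using U n by (auto simp: char_vec_def)
  have "(\<exists>\<gamma>. col U 0 = \<gamma> \<cdot>\<^sub>v char_vec n n) \<longleftrightarrow> (\<forall>i<n - 1. U $$ (i, 0) = 0)"
  proof
    assume "\<exists>\<gamma>. col U 0 = \<gamma> \<cdot>\<^sub>v char_vec n n"
    then obtain \<gamma> where \<gamma>: "col U 0 = \<gamma> \<cdot>\<^sub>v char_vec n n" ..
    show "\<forall>i<n - 1. U $$ (i, 0) = 0"
    proof (intro allI impI)
      fix i assume "i < n - 1"
      then show "U $$ (i, 0) = 0"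
        using arg_cong[OF \<gamma>, of "\<lambda>w. w $ i"] U n by (simp add: char_vec_def)
    qed
  next
    assume zero: "\<forall>i<n - 1. U $$ (i, 0) = 0"
    have "col U 0 = U $$ (n - 1, 0) \<cdot>\<^sub>v char_vec n n"
    proof (rule eq_vecI)
      fix i assume "i < dim_vec (U $$ (n - 1, 0) \<cdot>\<^sub>v char_vec n n)"
      then have "i < n" by (simp add: char_vec_def)
      then show "col U 0 $ i = (U $$ (n - 1, 0) \<cdot>\<^sub>v char_vec n n) $ i"
        using zero U n by (cases "i = n - 1") (auto simp: char_vec_def)
    qed (use U in \<open>simp add: char_vec_def\<close>)
    then show "\<exists>\<gamma>. col U 0 = \<gamma> \<cdot>\<^sub>v char_vec n n" ..
  qed
  then show ?thesis
    using n column by (auto simp: path_q_pst_def U_def path_q_evolution_def)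
qed

text \<open>Under perfect transfer the first column of the evolution matrix is a multiple \<open>\<gamma>\<close> of the last unit
  vector; pair it with the left eigenvector \<open>v\<close>.\<close>

lemma path_q_pst_ends_phase:
  assumes n: "n \<ge> 2" and pst: "path_q_pst n q 1 n \<tau>"
  shows "\<exists>\<gamma>. \<forall>x v. path_eigenvector n q x v \<longrightarrow>
      exp (\<i> * of_real \<tau> * path_q_eigenvalue q x) * v 0 = \<gamma> * v (n - 1)"
proof (intro exI allI impI)
  fix x v assume v: "path_eigenvector n q x v"
  have "exp (\<i> * of_real \<tau> * path_q_eigenvalue q x) * v 0
      = (\<Sum>i<n. v i * path_q_evolution n q \<tau> $$ (i, 0))"
    using path_q_evolution_left_eigenvector[OF n v, where \<tau> = \<tau>] by simp
  also have "\<dots> = (\<Sum>i<n. if i = n - 1 then path_q_evolution n q \<tau> $$ (i, 0) * v i else 0)"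
    using pst n unfolding path_q_pst_ends_iff[OF n] by (intro sum.cong) auto
  also have "\<dots> = path_q_evolution n q \<tau> $$ (n - 1, 0) * v (n - 1)"
    using n by simp
  finally show "exp (\<i> * of_real \<tau> * path_q_eigenvalue q x) * v 0
      = path_q_evolution n q \<tau> $$ (n - 1, 0) * v (n - 1)" .
qed

lemma exp_eq_minus_one_iff:
  "exp z = (- 1 :: complex) \<longleftrightarrow> (\<exists>k::int. odd k \<and> z = \<i> * (of_int k * pi))"
proof
  assume "exp z = - 1"
  then have polar: "exp (Re z) * cos (Im z) = - 1" "exp (Re z) * sin (Im z) = 0" "exp (Re z) = 1"
    using Re_exp[of z] Im_exp[of z] norm_exp_eq_Re[of z] by simp_all
  then have Re: "Re z = 0" and "cos (Im z - pi) = 1"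
    by simp_all
  then obtain n :: int where "Im z - pi = of_int n * 2 * pi"
    using cos_one_2pi_int by blast
  then have "z = \<i> * (of_int (2 * n + 1) * pi)"
    using Re by (simp add: complex_eq_iff algebra_simps)
  then show "\<exists>k::int. odd k \<and> z = \<i> * (of_int k * pi)"
    by (intro exI[of _ "2 * n + 1"]) simp
next
  assume "\<exists>k::int. odd k \<and> z = \<i> * (of_int k * pi)"
  then obtain n :: int where z: "z = \<i> * (of_int (2 * n + 1) * pi)"
    by (metis oddE)
  then have Im: "Im z = (2 * pi) * of_int n + pi" by (simp add: algebra_simps)
  have "cos (Im z) = - 1" "sin (Im z) = 0"
    unfolding Im cos_periodic_pi sin_periodic_pi cos_int_2pin sin_int_2pin by simp_all
  then show "exp z = - 1"
    by (simp add: complex_eq_iff Re_exp Im_exp) (simp add: z)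
qed

section \<open>Two and three vertices\<close>

text \<open>The symmetric and the skew-symmetric eigenvector have eigenvalues \<open>1 - q\<close> and \<open>1 + q\<close>, whose phases are
  opposite at this time; so the first entry of the first column vanishes.\<close>

lemma path_2_q_pst:
  assumes q: "q \<noteq> 0"
  shows "path_q_pst 2 q 1 2 (pi / (2 * \<bar>q\<bar>))"
proof -
  define \<tau> where "\<tau> = pi / (2 * \<bar>q\<bar>)"
  define U where "U i = path_q_evolution 2 q \<tau> $$ (i, 0)" for i
  define c where "c = exp (\<i> * \<tau> * (1 - q))"
  define d where "d = exp (\<i> * \<tau> * (1 + q))"
  have "(\<Sum>i<2. 1 * U i) = exp (\<i> * of_real \<tau> * path_q_eigenvalue q (of_real (q + 1))) * 1"
    unfolding U_def
    by (subst path_q_evolution_left_eigenvector[where x = "of_real (q + 1)"])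
      (simp_all add: path_eigenvector_def)
  then have sum: "U 0 + U 1 = c"
    by (simp add: c_def path_q_eigenvalue_def power2_eq_square numeral_2_eq_2 algebra_simps)
  have "(\<Sum>i<2. (if i = 0 then 1 else - 1) * U i) = exp (\<i> * of_real \<tau> * path_q_eigenvalue q (of_real (q - 1))) * 1"
    unfolding U_def
    by (subst path_q_evolution_left_eigenvector[where x = "of_real (q - 1)"])
      (simp_all add: path_eigenvector_def)
  then have diff: "U 0 - U 1 = d"
    by (simp add: d_def path_q_eigenvalue_def numeral_2_eq_2 algebra_simps power2_eq_square)
  have "2 * \<tau> * q = sgn q * pi"
    using q by (simp add: \<tau>_def sgn_real_def abs_if)
  then have "exp (\<i> * complex_of_real (2 * \<tau> * q)) = -1"
    unfolding exp_eq_minus_one_iff using q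
    by (intro exI[of _ "if q > 0 then 1 else - 1"]) (simp add: sgn_real_def)
  moreover have "d = c * exp (\<i> * complex_of_real (2 * \<tau> * q))"
    by (simp add: c_def d_def exp_add[symmetric] algebra_simps)
  ultimately have "(U 0 + U 1) + (U 0 - U 1) = 0" unfolding sum diff by simp
  then have "U 0 = 0" by simp
  moreover have "\<tau> > 0" using q by (simp add: \<tau>_def)
  ultimately show ?thesis
    unfolding \<tau>_def[symmetric] path_q_pst_ends_iff[OF order_refl] by (simp add: U_def)
qed

text \<open>Here \<open>a\<close> and \<open>b\<close> are the two symmetric eigenvalues minus the skew-symmetric eigenvalue \<open>1\<close>. The three
  eigenvectors determine the first column of the evolution matrix, with \<open>e\<close> below being the phase
  of the skew-symmetric one.\<close>

lemma path_3_q_pst_iff_phases: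
  fixes q a b :: real
  assumes q: "q \<noteq> 0" and "a \<noteq> b"
    and a: "a * (q\<^sup>2 - a) = - 2 * q\<^sup>2" and b: "b * (q\<^sup>2 - b) = - 2 * q\<^sup>2"
  shows "path_q_pst 3 q 1 3 \<tau> \<longleftrightarrow> \<tau> > 0 \<and> exp (\<i> * \<tau> * a) = - 1 \<and> exp (\<i> * \<tau> * b) = - 1"
proof -
  define U where "U i = path_q_evolution 3 q \<tau> $$ (i, 0)" for i
  define e where "e = exp (\<i> * \<tau>)"
  have e0: "e \<noteq> 0" by (simp add: e_def)
  \<comment> \<open>The skew-symmetric eigenvector, with eigenvalue \<open>1\<close>.\<close>
  define w :: "nat \<Rightarrow> complex" where "w i = (if i = 0 then 1 else if i = 1 then 0 else - 1)" for i
  have w: "U 0 - U 2 = e"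
    using path_q_evolution_left_eigenvector[where n = 3 and v = w and x = "of_real q" and q = q and \<tau> = \<tau>]
    by (simp add: path_q_eigenvalue_def path_eigenvector_def w_def U_def e_def eval_nat_numeral)
  have sym: "U 0 - c / q * U 1 + U 2 = e * exp (\<i> * \<tau> * c)"
    if c: "c * (q\<^sup>2 - c) = - 2 * q\<^sup>2" for c :: real
  proof -
    \<comment> \<open>Chosen such that the eigenvalue is \<open>1 + c\<close>; the middle entry of the symmetric
      eigenvector is then \<open>x - q = - c / q\<close>.\<close>
    define x where "x = q - c / q"
    define v :: "nat \<Rightarrow> complex" where "v i = (if i = 1 then of_real (- c / q) else 1)" for i
    have x: "x * (x - q) = 2"
      using c q unfolding x_def by (simp add: field_simps power2_eq_square)
    have "x * (- c / q) - 1 = 1"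
      using x by (simp add: x_def)
    from arg_cong[OF this, of complex_of_real]
    have v2: "of_real x * v 1 - 1 = 1" by (simp add: v_def)
    have "(\<Sum>i<3. v i * U i) = exp (\<i> * of_real \<tau> * path_q_eigenvalue q (of_real x)) * v 0"
      unfolding U_def
    proof (rule path_q_evolution_left_eigenvector)
      show "path_eigenvector 3 q (of_real x) v"
        using v2 by (simp add: path_eigenvector_def v_def) (simp add: x_def)
    qed simp
    moreover have "1 + q\<^sup>2 - q * x = 1 + c"
      using q by (simp add: x_def field_simps power2_eq_square)
    from arg_cong[OF this, of complex_of_real]
    have "path_q_eigenvalue q (of_real x) = 1 + c" by (simp add: path_q_eigenvalue_def)
    ultimately show ?thesis
      by (simp add: v_def e_def eval_nat_numeral algebra_simps exp_add)
  qed
  note syma = sym[OF a] and symb = sym[OF b]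
  have "(\<forall>i<2. U i = 0) \<longleftrightarrow> exp (\<i> * \<tau> * a) = - 1 \<and> exp (\<i> * \<tau> * b) = - 1"
  proof
    assume "\<forall>i<2. U i = 0"
    then have "U 0 = 0" "U 1 = 0" by auto
    moreover from this w have "U 2 = - e" by auto
    ultimately have "e * exp (\<i> * \<tau> * a) = e * - 1" "e * exp (\<i> * \<tau> * b) = e * - 1"
      unfolding syma[symmetric] symb[symmetric] by simp_all
    with e0 show "exp (\<i> * \<tau> * a) = - 1 \<and> exp (\<i> * \<tau> * b) = - 1"
      using mult_left_cancel by blast
  next
    assume phases: "exp (\<i> * \<tau> * a) = - 1 \<and> exp (\<i> * \<tau> * b) = - 1"
    have "(a - b) / q * U 1 = (U 0 - b / q * U 1 + U 2) - (U 0 - a / q * U 1 + U 2)"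
      by (simp add: field_simps diff_divide_distrib)
    also have "\<dots> = 0" using syma symb phases by simp
    finally have U1: "U 1 = 0" using q \<open>a \<noteq> b\<close> by (simp flip: of_real_diff)
    have "2 * U 0 = (U 0 - U 2) + (U 0 - a / q * U 1 + U 2)"
      using U1 by simp
    also have "\<dots> = 0" using syma w phases by simp
    finally have "U 0 = 0" by simp
    with U1 show "\<forall>i<2. U i = 0" by (simp add: less_2_cases_iff)
  qed
  moreover have le3: "2 \<le> (3::nat)" by simp
  ultimately show ?thesis
    unfolding path_q_pst_ends_iff[of 3 q \<tau>, OF le3] by (simp add: U_def)
qed

text \<open>With \<open>\<tau> * a = i * pi\<close> and \<open>\<tau> * b = j * pi\<close> for odd \<open>i\<close> and \<open>j\<close>, the integers \<open>k\<close> and \<open>l\<close> are half the difference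
  and half the sum; their parities differ because \<open>k + l = i\<close> is odd. The sum and the product of
  \<open>a\<close> and \<open>b\<close> give two equations that determine \<open>q\<^sup>2\<close> and \<open>\<tau>\<close>.\<close>

lemma path_3_q_pst_iff:
  fixes q \<tau> :: real
  assumes q: "q \<noteq> 0" and \<tau>: "\<tau> > 0"
  shows "path_q_pst 3 q 1 3 \<tau> \<longleftrightarrow>
     (\<exists>k l :: int. k > l \<and> k mod 2 \<noteq> l mod 2
        \<and> \<bar>q\<bar> = sqrt (8 * (real_of_int l)\<^sup>2 / ((real_of_int k)\<^sup>2 - (real_of_int l)\<^sup>2))
        \<and> \<tau> = pi * ((real_of_int k)\<^sup>2 - (real_of_int l)\<^sup>2) / (4 * real_of_int l))"
    (is "_ \<longleftrightarrow> ?R")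
proof -
  define r where "r = \<bar>q\<bar> * sqrt (q\<^sup>2 + 8)"
  define a where "a = (q\<^sup>2 + r) / 2"
  define b where "b = (q\<^sup>2 - r) / 2"
  have r2: "r\<^sup>2 = q\<^sup>2 * (q\<^sup>2 + 8)"
    by (simp add: r_def power_mult_distrib)
  have r0: "r > 0" using q by (simp add: r_def add_nonneg_pos)
  have q2: "q\<^sup>2 > 0" using q by simp
  have ab: "a * b = - 2 * q\<^sup>2" "a + b = q\<^sup>2"
    using r2 by (simp_all add: a_def b_def field_simps power2_eq_square)
  have "path_q_pst 3 q 1 3 \<tau> \<longleftrightarrow> exp (\<i> * \<tau> * a) = - 1 \<and> exp (\<i> * \<tau> * b) = - 1"
  proof -
    have diffs: "q\<^sup>2 - a = b" "q\<^sup>2 - b = a" using ab(2) by simp_all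
    have "a * (q\<^sup>2 - a) = - 2 * q\<^sup>2" "b * (q\<^sup>2 - b) = - 2 * q\<^sup>2"
      using ab(1) by (simp_all only: diffs mult.commute[of b a])
    moreover have "a \<noteq> b" using r0 by (simp add: a_def b_def)
    ultimately show ?thesis using path_3_q_pst_iff_phases[OF q, of a b \<tau>] \<tau> by simp
  qed
  also have "\<dots> \<longleftrightarrow> (\<exists>i j :: int. odd i \<and> odd j \<and> \<tau> * a = i * pi \<and> \<tau> * b = j * pi)"
  proof -
    have "exp (\<i> * \<tau> * c) = - 1 \<longleftrightarrow> (\<exists>k::int. odd k \<and> \<tau> * c = k * pi)" for c :: real
    proof -
      have "\<i> * complex_of_real \<tau> * complex_of_real c = \<i> * (complex_of_int k * complex_of_real pi)
          \<longleftrightarrow> \<tau> * c = k * pi" for k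
        by (metis (no_types, opaque_lifting) complex_i_not_zero mult.assoc mult_left_cancel
            of_real_eq_iff of_real_mult of_real_of_int_eq)
      then show ?thesis unfolding exp_eq_minus_one_iff by simp
    qed
    then show ?thesis by blast
  qed
  also have "\<dots> \<longleftrightarrow> ?R"
  proof
    assume "\<exists>i j :: int. odd i \<and> odd j \<and> \<tau> * a = i * pi \<and> \<tau> * b = j * pi"
    then obtain i j :: int where odd: "odd i" "odd j" and ij: "\<tau> * a = i * pi" "\<tau> * b = j * pi"
      by blast
    define k where "k = (i - j) div 2"
    define l where "l = (i + j) div 2"
    have kl: "i = k + l" "j = l - k"
      using odd unfolding k_def l_def by presburger+
    \<comment> \<open>The smaller root \<open>b\<close> is negative, which gives \<open>l - k = j < 0\<close>.\<close>
    have "sqrt (q\<^sup>2) < sqrt (q\<^sup>2 + 8)" by (rule real_sqrt_less_mono) simp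
    then have "\<bar>q\<bar> * \<bar>q\<bar> < r" unfolding r_def using q by (intro mult_strict_left_mono) auto
    then have "b < 0" by (simp add: b_def power2_eq_square abs_mult_self_eq)
    then have "\<tau> * b < 0" using \<tau> by (simp add: mult_pos_neg)
    then have "l < k" using ij(2) kl(2) by (simp add: mult_less_0_iff)
    have "\<tau> * q\<^sup>2 = \<tau> * a + \<tau> * b" unfolding ab(2)[symmetric] by (rule distrib_left)
    then have 1: "\<tau> * q\<^sup>2 = 2 * l * pi"
      unfolding ij by (simp add: kl algebra_simps)
    have "(\<tau> * a) * (\<tau> * b) = \<tau> * \<tau> * (- 2 * q\<^sup>2)"
      by (simp only: ab(1)[symmetric] mult_ac)
    then have "pi * pi * (k\<^sup>2 - l\<^sup>2) = 2 * \<tau> * (\<tau> * q\<^sup>2)"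
      unfolding ij by (simp add: kl algebra_simps power2_eq_square)
    then have 2: "pi * ((real_of_int k)\<^sup>2 - (real_of_int l)\<^sup>2) = 4 * l * \<tau>"
      unfolding 1 by (simp add: mult_ac)
    have "0 < 2 * l * pi" unfolding 1[symmetric] using \<tau> q2 by simp
    then have l: "l > 0" by (simp add: zero_less_mult_iff)
    have t: "\<tau> = pi * ((real_of_int k)\<^sup>2 - (real_of_int l)\<^sup>2) / (4 * real_of_int l)"
      using 2 l by (simp add: field_simps)
    have "pi * (q\<^sup>2 * ((real_of_int k)\<^sup>2 - (real_of_int l)\<^sup>2))
        = q\<^sup>2 * (pi * ((real_of_int k)\<^sup>2 - (real_of_int l)\<^sup>2))"
      by (simp only: mult_ac)
    also have "\<dots> = 4 * l * (\<tau> * q\<^sup>2)" unfolding 2 by (simp only: mult_ac)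
    also have "\<dots> = pi * (8 * (real_of_int l)\<^sup>2)" unfolding 1 by (simp add: power2_eq_square)
    finally have "pi * (q\<^sup>2 * ((real_of_int k)\<^sup>2 - (real_of_int l)\<^sup>2)) = pi * (8 * (real_of_int l)\<^sup>2)" .
    then have 3: "q\<^sup>2 * ((real_of_int k)\<^sup>2 - (real_of_int l)\<^sup>2) = 8 * (real_of_int l)\<^sup>2"
      using mult_left_cancel[OF pi_neq_zero] by blast
    then have "(real_of_int k)\<^sup>2 - (real_of_int l)\<^sup>2 \<noteq> 0" using l by auto
    with 3 have "q\<^sup>2 = 8 * (real_of_int l)\<^sup>2 / ((real_of_int k)\<^sup>2 - (real_of_int l)\<^sup>2)"
      by (simp add: field_simps)
    then have "\<bar>q\<bar> = sqrt (8 * (real_of_int l)\<^sup>2 / ((real_of_int k)\<^sup>2 - (real_of_int l)\<^sup>2))"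
      by (simp flip: real_sqrt_abs)
    moreover have "k mod 2 \<noteq> l mod 2" using odd kl by presburger
    ultimately show ?R using t \<open>l < k\<close> by blast
  next
    assume ?R
    then obtain k l :: int where kl: "k > l" "k mod 2 \<noteq> l mod 2"
        and qq: "\<bar>q\<bar> = sqrt (8 * (real_of_int l)\<^sup>2 / ((real_of_int k)\<^sup>2 - (real_of_int l)\<^sup>2))"
        and t: "\<tau> = pi * ((real_of_int k)\<^sup>2 - (real_of_int l)\<^sup>2) / (4 * real_of_int l)"
      by blast
    define D where "D = (real_of_int k)\<^sup>2 - (real_of_int l)\<^sup>2"
    \<comment> \<open>\<open>sqrt\<close> is odd and \<open>x / 0 = 0\<close>, so a positive square root forces a positive radicand.\<close>
    have pos: "8 * (real_of_int l)\<^sup>2 / D > 0" using qq q unfolding D_def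
      by (metis real_sqrt_gt_0_iff zero_less_abs_iff)
    then have D: "D > 0" by (simp add: zero_less_divide_iff)
    have l: "l > 0" using t \<tau> D unfolding D_def[symmetric] by (simp add: zero_less_divide_iff mult_less_0_iff)
    have qD: "q\<^sup>2 = 8 * (real_of_int l)\<^sup>2 / D"
      using qq pos unfolding D_def[symmetric] by (metis real_sqrt_abs real_sqrt_eq_iff)
    have k: "k > 0" using kl l by simp
    have tq: "\<tau> * q\<^sup>2 = 2 * l * pi"
      using l D unfolding t qD D_def[symmetric] by (simp add: field_simps power2_eq_square)
    have "q\<^sup>2 + 8 = 8 * (real_of_int k)\<^sup>2 / D"
      using D unfolding qD by (simp add: field_simps) (simp add: D_def)
    also have "\<dots> = q\<^sup>2 * ((real_of_int k)\<^sup>2 / (real_of_int l)\<^sup>2)"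
      using l unfolding qD by simp
    finally have "r\<^sup>2 = (q\<^sup>2 * k / l)\<^sup>2"
      unfolding r2 by (simp add: power_mult_distrib power_divide power2_eq_square)
    then have "r = q\<^sup>2 * k / l"
      using r0 k l by (simp add: power2_eq_iff_nonneg)
    then have "\<tau> * r = (\<tau> * q\<^sup>2) * k / l" by simp
    then have tr: "\<tau> * r = 2 * k * pi" unfolding tq using l by simp
    have "\<tau> * a = of_int (l + k) * pi" "\<tau> * b = of_int (l - k) * pi"
      using tq tr by (simp_all add: a_def b_def field_simps)
    moreover have "odd (l + k)" "odd (l - k)" using kl by presburger+
    ultimately show "\<exists>i j :: int. odd i \<and> odd j \<and> \<tau> * a = i * pi \<and> \<tau> * b = j * pi" by blast
  qed
  finally show ?thesis .
qed

text \<open>A pair with \<open>l < 0\<close> is admissible on the right but yields a negative time, so \<open>l\<close> is replaced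
  by its absolute value.\<close>

lemma path_3_q_pst_exists_iff:
  fixes q :: real
  assumes q: "q \<noteq> 0"
  shows "(\<exists>\<tau>. path_q_pst 3 q 1 3 \<tau>) \<longleftrightarrow>
     (\<exists>k l :: int. k > l \<and> k mod 2 \<noteq> l mod 2
        \<and> \<bar>q\<bar> = sqrt (8 * (real_of_int l)\<^sup>2 / ((real_of_int k)\<^sup>2 - (real_of_int l)\<^sup>2)))"
proof
  assume "\<exists>\<tau>. path_q_pst 3 q 1 3 \<tau>"
  then obtain \<tau> where "path_q_pst 3 q 1 3 \<tau>" ..
  moreover from this have "\<tau> > 0" by (simp add: path_q_pst_def)
  ultimately show "\<exists>k l :: int. k > l \<and> k mod 2 \<noteq> l mod 2
        \<and> \<bar>q\<bar> = sqrt (8 * (real_of_int l)\<^sup>2 / ((real_of_int k)\<^sup>2 - (real_of_int l)\<^sup>2))"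
    using path_3_q_pst_iff[OF q] by blast
next
  assume "\<exists>k l :: int. k > l \<and> k mod 2 \<noteq> l mod 2
        \<and> \<bar>q\<bar> = sqrt (8 * (real_of_int l)\<^sup>2 / ((real_of_int k)\<^sup>2 - (real_of_int l)\<^sup>2))"
  then obtain k l :: int where kl: "k > l" "k mod 2 \<noteq> l mod 2"
    and qq: "\<bar>q\<bar> = sqrt (8 * (real_of_int l)\<^sup>2 / ((real_of_int k)\<^sup>2 - (real_of_int l)\<^sup>2))"
    by blast
  define D where "D = (real_of_int k)\<^sup>2 - (real_of_int l)\<^sup>2"
  have pos: "8 * (real_of_int l)\<^sup>2 / D > 0" using qq q unfolding D_def
    by (metis real_sqrt_gt_0_iff zero_less_abs_iff)
  then have D: "D > 0" and l: "l \<noteq> 0" by (auto simp add: zero_less_divide_iff)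
  have "(real_of_int l)\<^sup>2 < (real_of_int k)\<^sup>2" using D by (simp add: D_def)
  then have "\<bar>l\<bar> < \<bar>k\<bar>" by (metis abs_le_square_iff not_le of_int_le_iff of_int_power)
  then have kl': "k > \<bar>l\<bar>" using kl by linarith
  have par: "k mod 2 \<noteq> \<bar>l\<bar> mod 2" using kl(2) by (simp add: mod_2_eq_odd)
  define \<tau> where "\<tau> = pi * ((real_of_int k)\<^sup>2 - (real_of_int \<bar>l\<bar>)\<^sup>2) / (4 * real_of_int \<bar>l\<bar>)"
  have "\<tau> > 0" using D l by (simp add: \<tau>_def D_def)
  moreover have "\<bar>q\<bar> = sqrt (8 * (real_of_int \<bar>l\<bar>)\<^sup>2 / ((real_of_int k)\<^sup>2 - (real_of_int \<bar>l\<bar>)\<^sup>2))"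
    using qq by simp
  ultimately have "path_q_pst 3 q 1 3 \<tau>"
    using path_3_q_pst_iff[OF q, of \<tau>] kl' par \<tau>_def by blast
  then show "\<exists>\<tau>. path_q_pst 3 q 1 3 \<tau>" ..
qed

section \<open>Resultants of monic complex polynomials\<close>

text \<open>The resultant of two monic polynomials up to sign. Only its modulus matters below, so no
  signs have to be tracked, and roots count with multiplicity.\<close>

definition abs_resultant :: "complex poly \<Rightarrow> complex poly \<Rightarrow> real" where
  "abs_resultant f g = (\<Prod>a\<in>#proots f. norm (poly g a))"

lemma monic_eq_prod_proots:
  fixes f :: "complex poly"
  assumes "lead_coeff f = 1"
  shows "(\<Prod>a\<in>#proots f. [:- a, 1:]) = f"
  using complex_poly_decompose_multiset[of f] assms by simp

lemma norm_poly_eq_prod_proots: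
  fixes f :: "complex poly"
  assumes "lead_coeff f = 1"
  shows "norm (poly f x) = (\<Prod>a\<in>#proots f. norm (x - a))"
proof -
  have "norm (poly (\<Prod>a\<in>#A. [:- a, 1:]) x) = (\<Prod>a\<in>#A. norm (x - a))" for A :: "complex multiset"
    by (induction A) (simp_all add: norm_mult del: mult_pCons_left)
  then show ?thesis using monic_eq_prod_proots[OF assms] by metis
qed

lemma abs_resultant_commute:
  assumes "lead_coeff f = 1" "lead_coeff g = 1"
  shows "abs_resultant f g = abs_resultant g f"
proof -
  have "abs_resultant f g = (\<Prod>a\<in>#proots f. \<Prod>b\<in>#proots g. norm (a - b))"
    unfolding abs_resultant_def norm_poly_eq_prod_proots[OF assms(2)] ..
  also have "\<dots> = (\<Prod>b\<in>#proots g. \<Prod>a\<in>#proots f. norm (b - a))"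
    by (subst prod_mset.swap) (simp add: norm_minus_commute)
  also have "\<dots> = abs_resultant g f"
    unfolding abs_resultant_def norm_poly_eq_prod_proots[OF assms(1)] ..
  finally show ?thesis .
qed

text \<open>The step of the Euclidean algorithm: only the values of the second polynomial at the roots of
  the first matter.\<close>

lemma abs_resultant_cong_at_roots:
  assumes "f \<noteq> 0" and "\<And>a. poly f a = 0 \<Longrightarrow> norm (poly g a) = c * norm (poly h a)"
  shows "abs_resultant f g = c ^ degree f * abs_resultant f h"
proof -
  have "abs_resultant f g = (\<Prod>a\<in>#proots f. c * norm (poly h a))"
    unfolding abs_resultant_def
    by (intro arg_cong[where f = prod_mset] image_mset_cong) (use assms in auto)
  then show ?thesis
    by (simp add: prod_mset.distrib abs_resultant_def size_proots_complex)
qed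

lemma coeff_prod_linear_first:
  fixes A :: "complex multiset"
  assumes "size A = Suc k"
  shows "coeff (\<Prod>a\<in>#A. [:- a, 1:]) k = - (\<Sum>a\<in>#A. a)"
proof -
  have top: "coeff (\<Prod>a\<in>#A. [:- a, 1:]) (size A) = 1 \<and>
      (\<forall>j>size A. coeff (\<Prod>a\<in>#A. [:- a, 1:]) j = 0)" for A :: "complex multiset"
    by (induction A) (auto simp: coeff_pCons split: nat.split)
  show ?thesis using assms
  proof (induction A arbitrary: k)
    case (add x A)
    show ?case
    proof (cases k)
      case 0
      then show ?thesis using add.prems by simp
    next
      case (Suc j)
      then show ?thesis using add.prems add.IH[of j] top[of A] by (simp add: algebra_simps)
    qed
  qed simp
qed

text \<open>Newton's identity for the second elementary symmetric function, which is this coefficient.\<close>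

lemma coeff_prod_linear_second:
  fixes A :: "complex multiset"
  assumes "size A = Suc (Suc k)"
  shows "2 * coeff (\<Prod>a\<in>#A. [:- a, 1:]) k = (\<Sum>a\<in>#A. a)\<^sup>2 - (\<Sum>a\<in>#A. a\<^sup>2)"
  using assms
proof (induction A arbitrary: k)
  case (add x A)
  show ?case
  proof (cases k)
    case 0
    then have "size A = 1" using add.prems by simp
    then obtain y where "A = {#y#}" using size_1_singleton_mset by blast
    then show ?thesis using 0 by (simp add: power2_eq_square algebra_simps)
  next
    case (Suc j)
    have "coeff (\<Prod>a\<in>#A. [:- a, 1:]) (Suc j) = - (\<Sum>a\<in>#A. a)"
      using add.prems Suc by (intro coeff_prod_linear_first) simp
    then show ?thesis
      using add.prems add.IH[of j] Suc by (simp add: power2_eq_square algebra_simps)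
  qed
qed simp

lemma sum_proots:
  fixes f :: "complex poly"
  assumes "lead_coeff f = 1" "degree f = Suc k"
  shows "(\<Sum>a\<in>#proots f. a) = - coeff f k"
  using coeff_prod_linear_first[of "proots f" k] assms
  by (simp add: monic_eq_prod_proots size_proots_complex)

lemma sum_squares_proots:
  fixes f :: "complex poly"
  assumes "lead_coeff f = 1" "degree f = Suc (Suc k)"
  shows "(\<Sum>a\<in>#proots f. a\<^sup>2) = (coeff f (Suc k))\<^sup>2 - 2 * coeff f k"
  using coeff_prod_linear_second[of "proots f" k] sum_proots[of f "Suc k"] assms
  by (simp add: monic_eq_prod_proots size_proots_complex algebra_simps)

section \<open>A 2-adic obstruction to odd root differences\<close>

text \<open>Compare the exponents of 2 on the two sides.\<close>

lemma dvd_of_odd_times_power_two: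
  fixes N r :: nat
  assumes eq: "2 ^ a * r = N ^ b" and r: "odd r"
  shows "b dvd a"
proof (cases "N = 0")
  case True
  then have "b = 0" using eq r by (cases "b = 0") (auto simp: power_0_left)
  then show ?thesis using eq by (cases a) auto
next
  case False
  have "r \<noteq> 0" using r by (intro notI) simp
  then have "multiplicity 2 (2 ^ a * r) = a"
    using r by (simp add: prime_elem_multiplicity_mult_distrib not_dvd_imp_multiplicity_0
        multiplicity_same_power)
  moreover have "multiplicity 2 (N ^ b) = b * multiplicity 2 N"
    using False by (simp add: prime_elem_multiplicity_power_distrib)
  ultimately show ?thesis using eq by (metis dvd_triv_left)
qed

lemma sum_mset_translated_multiples:
  fixes A :: "complex multiset"
  assumes "\<And>a. a \<in># A \<Longrightarrow> \<exists>k::int. f a = c + d * of_int k"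
  shows "\<exists>N::int. (\<Sum>a\<in>#A. f a) = of_nat (size A) * c + d * of_int N"
  using assms
proof (induction A)
  case empty
  show ?case by (intro exI[of _ 0]) simp
next
  case (add x A)
  from add obtain N :: int where N: "(\<Sum>a\<in>#A. f a) = of_nat (size A) * c + d * of_int N"
    by auto
  obtain k :: int where "f x = c + d * of_int k" using add.prems by auto
  then show ?case using N by (intro exI[of _ "N + k"]) (simp add: algebra_simps)
qed

lemma prod_mset_odd_multiples:
  fixes h :: "'a \<Rightarrow> real"
  assumes "\<And>a. a \<in># A \<Longrightarrow> \<exists>r::nat. odd r \<and> h a = d * real r"
  shows "\<exists>r::nat. odd r \<and> (\<Prod>a\<in>#A. h a) = d ^ size A * real r"
  using assms
proof (induction A)
  case empty
  show ?case by (intro exI[of _ 1]) simp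
next
  case (add x A)
  from add obtain r :: nat where r: "odd r" "(\<Prod>a\<in>#A. h a) = d ^ size A * real r"
    by auto
  obtain s :: nat where "odd s" "h x = d * real s" using add.prems by auto
  then show ?case using r by (intro exI[of _ "s * r"]) simp
qed

lemma abs_resultant_odd_differences:
  assumes f: "lead_coeff f = 1" and g: "g \<noteq> 0"
    and odd: "\<And>a b. poly f a = 0 \<Longrightarrow> poly g b = 0 \<Longrightarrow>
      \<exists>k::int. odd k \<and> a - b = complex_of_real d * of_int k"
  obtains r :: nat where "odd r" "abs_resultant g f = \<bar>d\<bar> ^ (degree f * degree g) * real r"
proof -
  have "f \<noteq> 0" using f by auto
  have "\<exists>r::nat. odd r \<and> norm (poly f b) = \<bar>d\<bar> ^ degree f * real r" if b: "poly g b = 0" for b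
  proof -
    have "\<exists>r::nat. odd r \<and> norm (b - a) = \<bar>d\<bar> * real r" if a: "poly f a = 0" for a
    proof -
      obtain k :: int where k: "odd k" "a - b = complex_of_real d * of_int k" using odd[OF a b] by blast
      have "norm (b - a) = \<bar>d\<bar> * \<bar>real_of_int k\<bar>"
        by (subst norm_minus_commute) (simp add: k norm_mult)
      then show ?thesis using k(1) by (intro exI[of _ "nat \<bar>k\<bar>"]) (simp add: even_nat_iff)
    qed
    then have "\<exists>r::nat. odd r \<and> (\<Prod>a\<in>#proots f. norm (b - a)) = \<bar>d\<bar> ^ size (proots f) * real r"
      using \<open>f \<noteq> 0\<close> by (intro prod_mset_odd_multiples) simp
    then show ?thesis
      by (simp add: norm_poly_eq_prod_proots[OF f] size_proots_complex)
  qed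
  then have "\<exists>r::nat. odd r \<and> abs_resultant g f = (\<bar>d\<bar> ^ degree f) ^ size (proots g) * real r"
    unfolding abs_resultant_def using g by (intro prod_mset_odd_multiples) simp
  then show ?thesis using that by (auto simp: size_proots_complex power_mult)
qed

text \<open>Any root of the second polynomial can serve as \<open>b0\<close>. A root of the first
  polynomial is an odd multiple of \<open>d\<close> away from it. Two roots of the second are both odd
  multiples of \<open>d\<close> away from a common root of the first.\<close>

lemma odd_differences_translated_multiples:
  fixes f g :: "complex poly"
  assumes "degree f > 0" "degree g > 0"
    and odd: "\<And>a b. poly f a = 0 \<Longrightarrow> poly g b = 0 \<Longrightarrow>
      \<exists>k::int. odd k \<and> a - b = complex_of_real d * of_int k"
  shows "\<exists>b0. (\<forall>a. poly f a = 0 \<longrightarrow> (\<exists>k::int. a = b0 + complex_of_real d * of_int k)) \<and>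
    (\<forall>b. poly g b = 0 \<longrightarrow> (\<exists>k::int. b = b0 + complex_of_real d * of_int k))"
proof -
  have "\<not> constant (poly f)" "\<not> constant (poly g)"
    using assms(1,2) by (simp_all add: constant_degree)
  then obtain a0 b0 where a0: "poly f a0 = 0" and b0: "poly g b0 = 0"
    using fundamental_theorem_of_algebra by meson
  have A: "\<exists>k::int. a = b0 + complex_of_real d * of_int k" if "poly f a = 0" for a
    using odd[OF that b0] by (metis add.commute diff_add_cancel)
  have B: "\<exists>k::int. b = b0 + complex_of_real d * of_int k" if b: "poly g b = 0" for b
  proof -
    obtain k l :: int where "a0 - b = complex_of_real d * of_int k" "a0 - b0 = complex_of_real d * of_int l"
      using odd[OF a0 b] odd[OF a0 b0] by blast
    then show ?thesis by (intro exI[of _ "l - k"]) (simp add: algebra_simps)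
  qed
  from A B show ?thesis by blast
qed

text \<open>The sums of the roots differ by \<open>2\<close> and also by an integral multiple \<open>d * N\<close>, the
  translation cancelling because the degrees agree; so \<open>\<bar>d\<bar> = 2 / \<bar>N\<bar>\<close>. Substituting this in
  \<open>\<bar>d\<bar>^(m * m) * r = 2^m\<close>, with \<open>r\<close> odd, makes \<open>2^(m * m - m)\<close> times an odd number a perfect
  \<open>m * m\<close>-th power, and \<open>m * m\<close> does not divide \<open>m * m - m\<close>.\<close>

lemma no_odd_differences_same_degree:
  fixes f g :: "complex poly"
  assumes f: "lead_coeff f = 1" "degree f = m" and g: "lead_coeff g = 1" "degree g = m"
    and m: "m \<ge> 2"
    and sum: "(\<Sum>a\<in>#proots f. a) - (\<Sum>b\<in>#proots g. b) = 2"
    and res: "abs_resultant g f = 2 ^ m"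
    and odd: "\<And>a b. poly f a = 0 \<Longrightarrow> poly g b = 0 \<Longrightarrow>
      \<exists>k::int. odd k \<and> a - b = complex_of_real d * of_int k"
  shows False
proof -
  have nz: "f \<noteq> 0" "g \<noteq> 0" using f(1) g(1) by auto
  obtain b0
    where A: "\<forall>a. poly f a = 0 \<longrightarrow> (\<exists>k::int. a = b0 + complex_of_real d * of_int k)"
      and B: "\<forall>b. poly g b = 0 \<longrightarrow> (\<exists>k::int. b = b0 + complex_of_real d * of_int k)"
    using odd_differences_translated_multiples[of f g d] f g m odd by auto
  obtain N1 :: int where N1: "(\<Sum>a\<in>#proots f. a) = of_nat m * b0 + complex_of_real d * of_int N1"
    using sum_mset_translated_multiples[of "proots f" "\<lambda>a. a" b0 "of_real d"] A f nz
    by (auto simp: size_proots_complex)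
  obtain N2 :: int where N2: "(\<Sum>b\<in>#proots g. b) = of_nat m * b0 + complex_of_real d * of_int N2"
    using sum_mset_translated_multiples[of "proots g" "\<lambda>a. a" b0 "of_real d"] B g nz
    by (auto simp: size_proots_complex)
  have "complex_of_real (d * of_int (N1 - N2)) = complex_of_real 2"
    using sum unfolding N1 N2 by (simp add: algebra_simps)
  then have "d * of_int (N1 - N2) = 2" using of_real_eq_iff by blast
  then have "\<bar>d\<bar> * \<bar>real_of_int (N1 - N2)\<bar> = 2" by (simp flip: abs_mult)
  moreover define N where "N = nat \<bar>N1 - N2\<bar>"
  ultimately have dN: "\<bar>d\<bar> * real N = 2" by simp
  obtain r :: nat where r: "odd r" "2 ^ m = \<bar>d\<bar> ^ (m * m) * real r"
    using abs_resultant_odd_differences[of f g d] f g nz odd res by metis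
  have "real (2 ^ m * N ^ (m * m)) = \<bar>d\<bar> ^ (m * m) * real r * real N ^ (m * m)"
    by (simp flip: r(2))
  also have "\<dots> = (\<bar>d\<bar> * real N) ^ (m * m) * real r"
    by (simp add: power_mult_distrib)
  also have "\<dots> = real (2 ^ (m * m) * r)" unfolding dN by simp
  finally have "2 ^ m * N ^ (m * m) = 2 ^ (m * m) * r" using of_nat_eq_iff by blast
  moreover have "m * m = m + m * (m - 1)" using m by (simp add: diff_mult_distrib2)
  then have "(2::nat) ^ (m * m) = 2 ^ m * 2 ^ (m * (m - 1))" by (metis power_add)
  ultimately have "2 ^ (m * (m - 1)) * r = N ^ (m * m)" by simp
  then have "m * m dvd m * (m - 1)" using r(1) dvd_of_odd_times_power_two by blast
  then have "m dvd m - 1" using m by simp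
  then show False using m dvd_imp_le[of m "m - 1"] by simp
qed

text \<open>Here the equality of the sums of roots forces the translation itself to be a multiple
  of \<open>d\<close>, so that all roots are. The sums of squares then give \<open>d\<^sup>2 * N = 4\<close>, and the square of the
  resultant identity makes \<open>2^(2 * m * m)\<close> times an odd number a perfect \<open>m * (m + 1)\<close>-th power;
  but \<open>m + 1\<close> divides \<open>2 * m\<close> only for \<open>m \<le> 1\<close>.\<close>

lemma no_odd_differences_consecutive_degrees:
  fixes f g :: "complex poly"
  assumes f: "lead_coeff f = 1" "degree f = Suc m" and g: "lead_coeff g = 1" "degree g = m"
    and m: "m \<ge> 2"
    and sum: "(\<Sum>a\<in>#proots f. a) = (\<Sum>b\<in>#proots g. b)"
    and squares: "(\<Sum>a\<in>#proots f. a\<^sup>2) - (\<Sum>b\<in>#proots g. b\<^sup>2) = 4"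
    and res: "abs_resultant g f = 2 ^ m"
    and odd: "\<And>a b. poly f a = 0 \<Longrightarrow> poly g b = 0 \<Longrightarrow>
      \<exists>k::int. odd k \<and> a - b = complex_of_real d * of_int k"
  shows False
proof -
  have nz: "f \<noteq> 0" "g \<noteq> 0" using f(1) g(1) by auto
  obtain b0
    where A: "\<forall>a. poly f a = 0 \<longrightarrow> (\<exists>k::int. a = b0 + complex_of_real d * of_int k)"
      and B: "\<forall>b. poly g b = 0 \<longrightarrow> (\<exists>k::int. b = b0 + complex_of_real d * of_int k)"
    using odd_differences_translated_multiples[of f g d] f g m odd by auto
  obtain N1 :: int where N1: "(\<Sum>a\<in>#proots f. a) = of_nat (Suc m) * b0 + complex_of_real d * of_int N1"
    using sum_mset_translated_multiples[of "proots f" "\<lambda>a. a" b0 "of_real d"] A f nz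
    by (auto simp: size_proots_complex)
  obtain N2 :: int where N2: "(\<Sum>b\<in>#proots g. b) = of_nat m * b0 + complex_of_real d * of_int N2"
    using sum_mset_translated_multiples[of "proots g" "\<lambda>a. a" b0 "of_real d"] B g nz
    by (auto simp: size_proots_complex)
  have b0_eq: "b0 = complex_of_real d * of_int (N2 - N1)"
    using sum unfolding N1 N2 by (simp add: algebra_simps)
  have shift: "\<exists>l::int. (b0 + complex_of_real d * of_int k)\<^sup>2 = 0 + complex_of_real (d\<^sup>2) * of_int l" for k
    unfolding b0_eq by (intro exI[of _ "(N2 - N1 + k)\<^sup>2"]) (simp add: algebra_simps power2_eq_square)
  have A2: "\<exists>l::int. a\<^sup>2 = 0 + complex_of_real (d\<^sup>2) * of_int l" if "poly f a = 0" for a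
    using A[rule_format, OF that] shift by blast
  have B2: "\<exists>l::int. b\<^sup>2 = 0 + complex_of_real (d\<^sup>2) * of_int l" if "poly g b = 0" for b
    using B[rule_format, OF that] shift by blast
  obtain M1 :: int where M1: "(\<Sum>a\<in>#proots f. a\<^sup>2) = complex_of_real (d\<^sup>2) * of_int M1"
    using sum_mset_translated_multiples[of "proots f" "\<lambda>a. a\<^sup>2" 0 "of_real (d\<^sup>2)"] A2 nz
    by auto
  obtain M2 :: int where M2: "(\<Sum>b\<in>#proots g. b\<^sup>2) = complex_of_real (d\<^sup>2) * of_int M2"
    using sum_mset_translated_multiples[of "proots g" "\<lambda>a. a\<^sup>2" 0 "of_real (d\<^sup>2)"] B2 nz
    by auto
  have "complex_of_real (d\<^sup>2 * of_int (M1 - M2)) = complex_of_real 4"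
    using squares unfolding M1 M2 by (simp add: algebra_simps)
  then have "d\<^sup>2 * of_int (M1 - M2) = 4" using of_real_eq_iff by blast
  then have "\<bar>d\<^sup>2 * of_int (M1 - M2)\<bar> = 4" by (metis abs_numeral)
  then have "\<bar>d\<^sup>2\<bar> * \<bar>real_of_int (M1 - M2)\<bar> = 4" unfolding abs_mult .
  moreover define N where "N = nat \<bar>M1 - M2\<bar>"
  ultimately have dN: "d\<^sup>2 * real N = 4" by simp
  define e where "e = Suc m * m"
  obtain r :: nat where r: "odd r" "2 ^ m = \<bar>d\<bar> ^ e * real r"
    using abs_resultant_odd_differences[of f g d] f g nz odd res unfolding e_def by metis
  have "(2::real) ^ (2 * m) = (\<bar>d\<bar> ^ e * real r)\<^sup>2"
    by (simp add: power_mult power_commutes[of 2] flip: r(2)) (simp add: power2_eq_square flip: power_mult_distrib)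
  also have "\<dots> = (d\<^sup>2) ^ e * (real r)\<^sup>2"
    by (simp add: power_mult_distrib power_even_abs flip: power_mult) (simp add: mult.commute power_even_abs)
  finally have "real (2 ^ (2 * m) * N ^ e) = (d\<^sup>2 * real N) ^ e * (real r)\<^sup>2"
    by (simp add: power_mult_distrib)
  also have "\<dots> = real (2 ^ (2 * e) * r\<^sup>2)" unfolding dN by (simp add: power_mult)
  finally have "2 ^ (2 * m) * N ^ e = 2 ^ (2 * e) * r\<^sup>2" using of_nat_eq_iff by blast
  moreover have "2 * e = 2 * m + m * (2 * m)" by (simp add: e_def algebra_simps)
  then have "(2::nat) ^ (2 * e) = 2 ^ (2 * m) * 2 ^ (m * (2 * m))" by (metis power_add)
  ultimately have "2 ^ (m * (2 * m)) * r\<^sup>2 = N ^ e" by simp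
  then have "e dvd m * (2 * m)" using r(1) dvd_of_odd_times_power_two[of _ "r\<^sup>2"] by simp
  then have "m * Suc m dvd m * (2 * m)" by (simp add: e_def mult.commute)
  then have "Suc m dvd 2 * m" using m by (simp del: mult_Suc mult_Suc_right)
  then have "Suc m dvd 2 * Suc m - 2 * m" by (rule dvd_diff_nat[OF dvd_triv_right])
  then show False using m dvd_imp_le[of "Suc m" 2] by simp
qed

section \<open>Paths with at least four vertices\<close>

text \<open>The characteristic polynomials, up to constant factors, of the leading principal blocks of the
  \<open>q\<close>-Laplacian of a long path, in the variable \<open>x\<close> of \<open>path_eigenvector\<close> and with \<open>c = q\<close>. As
  functions of the index they solve the eigenvector recurrence with first entry \<open>1\<close>.\<close>

fun path_poly :: "complex \<Rightarrow> nat \<Rightarrow> complex poly" where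
  "path_poly c 0 = 1"
| "path_poly c (Suc 0) = [:- c, 1:]"
| "path_poly c (Suc (Suc k)) = pCons 0 (path_poly c (Suc k)) - path_poly c k"

lemma coeff_path_poly_above: "j > k \<Longrightarrow> coeff (path_poly c k) j = 0"
  by (induction c k arbitrary: j rule: path_poly.induct)
    (auto simp: coeff_pCons split: nat.split)

lemma coeff_path_poly_top: "coeff (path_poly c k) k = 1"
  by (induction c k rule: path_poly.induct) (auto simp: coeff_path_poly_above)

lemma coeff_path_poly_first: "coeff (path_poly c (Suc k)) k = - c"
proof (induction k)
  case (Suc k)
  then show ?case by (simp add: coeff_path_poly_above)
qed simp

lemma coeff_path_poly_second: "coeff (path_poly c (Suc (Suc k))) k = - of_nat (Suc k)"
proof (induction k)
  case (Suc k)
  then show ?case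
    by (subst path_poly.simps(3)) (simp add: coeff_path_poly_top del: path_poly.simps(3))
qed simp

lemma degree_path_poly: "degree (path_poly c k) = k"
  by (intro antisym degree_le le_degree) (auto simp: coeff_path_poly_above coeff_path_poly_top)

lemma path_poly_monic: "lead_coeff (path_poly c k) = 1"
  by (simp add: degree_path_poly coeff_path_poly_top)

lemma path_poly_nonzero: "path_poly c k \<noteq> 0"
  using path_poly_monic[of c k] by auto

lemma poly_path_poly_rec:
  "poly (path_poly c (j + 2)) x = x * poly (path_poly c (j + 1)) x - poly (path_poly c j) x"
  by simp

text \<open>The recurrence is a division with remainder, so the induction is the Euclidean algorithm.\<close>

lemma abs_resultant_path_poly:
  "abs_resultant (path_poly c (Suc k)) (path_poly c k) = 1"
proof (induction k)
  case 0
  show ?case by (simp add: abs_resultant_def)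
next
  case (Suc k)
  have "abs_resultant (path_poly c (Suc (Suc k))) (path_poly c (Suc k))
      = abs_resultant (path_poly c (Suc k)) (path_poly c (Suc (Suc k)))"
    by (intro abs_resultant_commute path_poly_monic)
  also have "\<dots> = 1 ^ degree (path_poly c (Suc k))
      * abs_resultant (path_poly c (Suc k)) (path_poly c k)"
    by (intro abs_resultant_cong_at_roots path_poly_nonzero) simp
  finally show ?case using Suc by simp
qed

text \<open>The three-term recurrence is invariant under reversal of the index, so a (skew-)symmetry of
  two adjacent entries about the centre of the path propagates to its ends.\<close>

lemma recurrence_reflect:
  fixes f :: "nat \<Rightarrow> complex"
  assumes rec: "\<And>j. f (j + 2) = x * f (j + 1) - f j"
    and "f a = s * f b" "f (a + 1) = s * f (b - 1)"
    and "k \<le> b"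
  shows "f (a + k) = s * f (b - k)"
  using \<open>k \<le> b\<close>
proof (induction k rule: less_induct)
  case (less k)
  consider "k = 0" | "k = 1" | j where "k = j + 2"
    by (metis One_nat_def add_2_eq_Suc' not0_implies_Suc)
  then show ?case
  proof cases
    case 3
    define i where "i = b - k"
    have b: "b - j = i + 2" "b - (j + 1) = i + 1" "b - k = i"
      using less.prems 3 by (auto simp: i_def)
    have "f (a + k) = x * f (a + (j + 1)) - f (a + j)"
      using rec[of "a + j"] 3 by (simp add: add.assoc)
    also have "\<dots> = x * (s * f (i + 1)) - s * f (i + 2)"
      using less.IH[of j] less.IH[of "j + 1"] less.prems 3 b by simp
    also have "\<dots> = s * f i"
      unfolding rec[of i] by (simp add: algebra_simps)
    finally show ?thesis using b by simp
  qed (use assms in auto)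
qed

text \<open>A root \<open>x\<close> gives a symmetric eigenvector of the path and a root \<open>y\<close> a skew-symmetric one, because
  their entries agree up to sign around the centre. The ratio of the last entry to the first is \<open>1\<close>
  for \<open>x\<close> and \<open>- 1\<close> for \<open>y\<close>, so perfect transfer gives the two eigenvalues opposite phases.
  The roots may be any complex numbers: an exponential equal to \<open>- 1\<close> makes the difference real.\<close>

lemma path_q_pst_odd_differences:
  assumes n: "n \<ge> 2" and q: "q \<noteq> 0" and pst: "path_q_pst n q 1 n \<tau>"
    and ab: "a + b = n - 1" "b \<ge> 1"
    and x: "poly (path_poly q a) x = poly (path_poly q b) x"
      "poly (path_poly q (a + 1)) x = poly (path_poly q (b - 1)) x"
    and y: "poly (path_poly q a) y = - poly (path_poly q b) y"
      "poly (path_poly q (a + 1)) y = - poly (path_poly q (b - 1)) y"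
  shows "\<exists>k::int. odd k \<and> x - y = complex_of_real (pi / (\<tau> * q)) * of_int k"
proof -
  from path_q_pst_ends_phase[OF n pst]
  obtain \<gamma> where \<gamma>: "\<forall>x v. path_eigenvector n q x v \<longrightarrow>
      exp (\<i> * of_real \<tau> * path_q_eigenvalue q x) * v 0 = \<gamma> * v (n - 1)" ..
  have phase: "exp (\<i> * of_real \<tau> * path_q_eigenvalue q z) = \<gamma> * s"
    if sym: "poly (path_poly q a) z = s * poly (path_poly q b) z"
      "poly (path_poly q (a + 1)) z = s * poly (path_poly q (b - 1)) z" for z s
  proof -
    define v where "v j = poly (path_poly q j) z" for j
    have rec: "v (j + 2) = z * v (j + 1) - v j" for j
      unfolding v_def by (rule poly_path_poly_rec)
    have refl: "v (a + k) = s * v (b - k)" if "k \<le> b" for k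
      by (rule recurrence_reflect[where f = v and x = z, OF rec])
        (use sym that in \<open>simp_all add: v_def\<close>)
    have v01: "v 0 = 1" "v 1 = z - q" by (simp_all add: v_def)
    have ends: "v (n - 1) = s" "v (n - 2) = s * (z - q)"
    proof -
      have "n - 1 = a + b" "n - 2 = a + (b - 1)" using ab n by auto
      then show "v (n - 1) = s" "v (n - 2) = s * (z - q)"
        using refl[of b] refl[of "b - 1"] ab v01 by simp_all
    qed
    have "exp (\<i> * of_real \<tau> * path_q_eigenvalue q z) * v 0 = \<gamma> * v (n - 1)"
      by (rule \<gamma>[rule_format]) (simp add: path_eigenvector_def ends v01 rec
          del: One_nat_def add_2_eq_Suc')
    then show ?thesis unfolding ends v01 by simp
  qed
  have ex: "exp (\<i> * of_real \<tau> * path_q_eigenvalue q x) = \<gamma>"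
    using phase[of x 1] x by simp
  have ey: "exp (\<i> * of_real \<tau> * path_q_eigenvalue q y) = - \<gamma>"
    using phase[of y "- 1"] y by simp
  have "\<gamma> \<noteq> 0" using ex exp_not_eq_zero by metis
  have "exp (\<i> * (\<tau> * q * (x - y)))
      = exp (\<i> * of_real \<tau> * path_q_eigenvalue q y) / exp (\<i> * of_real \<tau> * path_q_eigenvalue q x)"
    by (simp add: path_q_eigenvalue_def exp_diff[symmetric] algebra_simps)
  also have "\<dots> = - 1" using ex ey \<open>\<gamma> \<noteq> 0\<close> by simp
  finally obtain k :: int where k: "odd k" "\<i> * (\<tau> * q * (x - y)) = \<i> * (of_int k * pi)"
    unfolding exp_eq_minus_one_iff by blast
  have "\<tau> > 0" using pst by (simp add: path_q_pst_def)
  moreover have "\<tau> * q * (x - y) = of_int k * pi"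
    using k(2) by (simp only: mult_cancel_left complex_i_not_zero simp_thms)
  ultimately have "x - y = complex_of_real (pi / (\<tau> * q)) * of_int k"
    using q by (simp add: field_simps)
  then show ?thesis using k(1) by blast
qed

lemma monic_diff_lower:
  fixes f g :: "complex poly"
  assumes "lead_coeff f = 1" "degree g < degree f"
  shows "lead_coeff (f - g) = 1" "degree (f - g) = degree f"
proof -
  show "degree (f - g) = degree f"
    using degree_add_eq_left[of "- g" f] assms by simp
  then show "lead_coeff (f - g) = 1" using assms by (simp add: coeff_eq_0)
qed

text \<open>The symmetric eigenvectors of a path with \<open>2 * m\<close> vertices are those with equal entries at
  the two middle vertices, the skew-symmetric ones those with opposite entries; hence the factors
  \<open>f\<close> and \<open>g\<close> of the characteristic polynomial.\<close>

lemma no_pst_even_path: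
  assumes m: "m \<ge> 2" and q: "q \<noteq> 0"
  shows "\<not> path_q_pst (2 * m) q 1 (2 * m) \<tau>"
proof
  assume pst: "path_q_pst (2 * m) q 1 (2 * m) \<tau>"
  obtain k where k: "m = Suc k" using m by (cases m) auto
  let ?p = "path_poly (complex_of_real q)"
  define f where "f = ?p (Suc k) - ?p k"
  define g where "g = ?p (Suc k) - (- ?p k)"
  have f: "lead_coeff f = 1" "degree f = m"
    using monic_diff_lower[of "?p (Suc k)" "?p k"] path_poly_monic[of "complex_of_real q"]
    by (simp_all add: f_def k degree_path_poly)
  have g: "lead_coeff g = 1" "degree g = m"
    using monic_diff_lower[of "?p (Suc k)" "- ?p k"] path_poly_monic[of "complex_of_real q"]
    by (simp_all add: g_def k degree_path_poly)
  have nz: "g \<noteq> 0" using g(1) by auto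
  have "(\<Sum>a\<in>#proots f. a) - (\<Sum>b\<in>#proots g. b) = 2"
    using f g sum_proots[of f k] sum_proots[of g k] unfolding k
    by (simp add: f_def g_def coeff_path_poly_top)
  moreover have "abs_resultant g f = 2 ^ m"
  proof -
    have "abs_resultant g f = 2 ^ degree g * abs_resultant g (?p k)"
    proof (rule abs_resultant_cong_at_roots[OF nz])
      fix b assume "poly g b = 0"
      then have "poly (?p (Suc k)) b = - poly (?p k) b" by (simp add: g_def add_eq_0_iff)
      then have "poly f b = (- 2) * poly (?p k) b" by (simp add: f_def)
      then show "norm (poly f b) = 2 * norm (poly (?p k) b)" by (simp add: norm_mult)
    qed
    also have "abs_resultant g (?p k) = abs_resultant (?p k) g"
      by (intro abs_resultant_commute g path_poly_monic)
    also have "\<dots> = 1 ^ degree (?p k) * abs_resultant (?p k) (?p (Suc k))"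
      by (intro abs_resultant_cong_at_roots path_poly_nonzero) (simp add: g_def)
    also have "abs_resultant (?p k) (?p (Suc k)) = 1"
      using abs_resultant_path_poly abs_resultant_commute[OF path_poly_monic path_poly_monic]
      by metis
    finally show ?thesis using g by simp
  qed
  moreover have "\<exists>i::int. odd i \<and> a - b = complex_of_real (pi / (\<tau> * q)) * of_int i"
    if "poly f a = 0" "poly g b = 0" for a b
    using that
    by (intro path_q_pst_odd_differences[OF _ q pst, of k "Suc k"])
      (auto simp: f_def g_def k add_eq_0_iff)
  ultimately show False
    using no_odd_differences_same_degree[OF f g m] by blast
qed

text \<open>With a middle vertex, skew-symmetry means a zero entry there, and symmetry means equal entries
  at its two neighbours; hence the factors \<open>g\<close> and \<open>f\<close>.\<close>

lemma no_pst_odd_path: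
  assumes m: "m \<ge> 2" and q: "q \<noteq> 0"
  shows "\<not> path_q_pst (2 * m + 1) q 1 (2 * m + 1) \<tau>"
proof
  assume pst: "path_q_pst (2 * m + 1) q 1 (2 * m + 1) \<tau>"
  obtain k where k: "m = Suc (Suc k)" using m by (metis add_2_eq_Suc le_Suc_ex)
  let ?p = "path_poly (complex_of_real q)"
  define f where "f = ?p (Suc m) - ?p (Suc k)"
  define g where "g = ?p m"
  have f: "lead_coeff f = 1" "degree f = Suc m"
    using monic_diff_lower[of "?p (Suc m)" "?p (Suc k)"] path_poly_monic[of "complex_of_real q"]
    by (simp_all only: f_def degree_path_poly) (simp_all add: k)
  have g: "lead_coeff g = 1" "degree g = m"
    using path_poly_monic by (auto simp: g_def degree_path_poly)
  have nz: "g \<noteq> 0" using g(1) by auto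
  have cf: "coeff f m = - complex_of_real q" "coeff f (Suc k) = - of_nat m - 1"
  proof -
    have "coeff (?p (Suc m)) m = - complex_of_real q" by (rule coeff_path_poly_first)
    moreover have "coeff (?p (Suc m)) (Suc k) = - of_nat m"
      unfolding k by (rule coeff_path_poly_second)
    moreover have "coeff (?p (Suc k)) m = 0" by (rule coeff_path_poly_above) (simp add: k)
    moreover have "coeff (?p (Suc k)) (Suc k) = 1" by (rule coeff_path_poly_top)
    ultimately show "coeff f m = - complex_of_real q" "coeff f (Suc k) = - of_nat m - 1"
      unfolding f_def coeff_diff by simp_all
  qed
  have cg: "coeff g (Suc k) = - complex_of_real q" "coeff g k = - of_nat (Suc k)"
    unfolding g_def k by (rule coeff_path_poly_first coeff_path_poly_second)+
  have sum: "(\<Sum>a\<in>#proots f. a) = (\<Sum>b\<in>#proots g. b)"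
    using sum_proots[OF f] sum_proots[of g "Suc k"] g cf cg by (simp add: k)
  have squares: "(\<Sum>a\<in>#proots f. a\<^sup>2) - (\<Sum>b\<in>#proots g. b\<^sup>2) = 4"
    using sum_squares_proots[of f "Suc k"] sum_squares_proots[of g k] f g cf cg
    by (simp add: k)
  have rec: "poly (?p (Suc m)) z = z * poly (?p m) z - poly (?p (Suc k)) z" for z
    by (simp add: k)
  have res: "abs_resultant g f = 2 ^ m"
  proof -
    have "abs_resultant g f = 2 ^ degree g * abs_resultant g (?p (Suc k))"
    proof (rule abs_resultant_cong_at_roots[OF nz])
      fix b assume "poly g b = 0"
      then have "poly f b = (- 2) * poly (?p (Suc k)) b" by (simp add: f_def g_def rec)
      then show "norm (poly f b) = 2 * norm (poly (?p (Suc k)) b)" by (simp add: norm_mult)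
    qed
    then show ?thesis using g abs_resultant_path_poly[of q "Suc k"] by (simp add: g_def k)
  qed
  have "\<exists>i::int. odd i \<and> a - b = complex_of_real (pi / (\<tau> * q)) * of_int i"
    if a: "poly f a = 0" and b: "poly g b = 0" for a b
  proof (rule path_q_pst_odd_differences[OF _ q pst, of m m])
    show "poly (?p (m + 1)) a = poly (?p (m - 1)) a" using a by (simp add: f_def k)
    show "poly (?p (m + 1)) b = - poly (?p (m - 1)) b" using b rec by (simp add: g_def k)
    show "poly (?p m) b = - poly (?p m) b" using b by (simp add: g_def)
  qed (use m in auto)
  then show False
    using no_odd_differences_consecutive_degrees[OF f g m sum squares res] by blast
qed

theorem theorem9:
  shows "(\<forall>n\<ge>2. (\<exists>q. q \<noteq> 0 \<and> (\<exists>\<tau>. path_q_pst n q 1 n \<tau>)) \<longleftrightarrow> n = 2 \<or> n = 3)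
    \<and> (\<forall>q. q \<noteq> 0 \<longrightarrow> path_q_pst 2 q 1 2 (pi / (2 * \<bar>q\<bar>)))
    \<and> (\<forall>q. q \<noteq> 0 \<longrightarrow>
          ((\<exists>\<tau>. path_q_pst 3 q 1 3 \<tau>) \<longleftrightarrow>
             (\<exists>k l :: int. k > l \<and> k mod 2 \<noteq> l mod 2
                \<and> \<bar>q\<bar> = sqrt (8 * (real_of_int l)\<^sup>2 / ((real_of_int k)\<^sup>2 - (real_of_int l)\<^sup>2))))
        \<and> (\<forall>\<tau>>0. path_q_pst 3 q 1 3 \<tau> \<longleftrightarrow>
             (\<exists>k l :: int. k > l \<and> k mod 2 \<noteq> l mod 2
                \<and> \<bar>q\<bar> = sqrt (8 * (real_of_int l)\<^sup>2 / ((real_of_int k)\<^sup>2 - (real_of_int l)\<^sup>2))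
                \<and> \<tau> = pi * ((real_of_int k)\<^sup>2 - (real_of_int l)\<^sup>2) / (4 * real_of_int l))))"
proof (intro conjI allI impI)
  fix n :: nat assume n: "n \<ge> 2"
  show "(\<exists>q. q \<noteq> 0 \<and> (\<exists>\<tau>. path_q_pst n q 1 n \<tau>)) \<longleftrightarrow> n = 2 \<or> n = 3"
  proof
    assume "\<exists>q. q \<noteq> 0 \<and> (\<exists>\<tau>. path_q_pst n q 1 n \<tau>)"
    then obtain q \<tau> where q: "q \<noteq> 0" and pst: "path_q_pst n q 1 n \<tau>" by blast
    show "n = 2 \<or> n = 3"
    proof (rule ccontr)
      assume "\<not> (n = 2 \<or> n = 3)"
      then have n4: "n \<ge> 4" using n by simp
      show False
      proof (cases "even n")
        case True
        then obtain m where "n = 2 * m" by (elim evenE)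
        then show False using no_pst_even_path[OF _ q] pst n4 by auto
      next
        case False
        then obtain m where "n = 2 * m + 1" by (elim oddE)
        then show False using no_pst_odd_path[OF _ q] pst n4 by auto
      qed
    qed
  next
    assume "n = 2 \<or> n = 3"
    then show "\<exists>q. q \<noteq> 0 \<and> (\<exists>\<tau>. path_q_pst n q 1 n \<tau>)"
    proof
      assume "n = 2"
      then show ?thesis using path_2_q_pst[of 1] by (intro exI[of _ 1]) auto
    next
      assume n3: "n = 3"
      \<comment> \<open>The smallest admissible pair is \<open>k = 2\<close>, \<open>l = 1\<close>.\<close>
      define q :: real where "q = sqrt (8 / 3)"
      have q: "q \<noteq> 0" by (simp add: q_def)
      have "\<exists>\<tau>. path_q_pst 3 q 1 3 \<tau>"
        unfolding path_3_q_pst_exists_iff[OF q]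
        by (intro exI[of _ 2] exI[of _ 1]) (simp add: q_def)
      then show ?thesis using q n3 by blast
    qed
  qed
qed (rule path_2_q_pst path_3_q_pst_exists_iff path_3_q_pst_iff; assumption)+

end
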